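(* Let $v,\lambda,\mu>0$, $p\in(0,1]$, $D_a=\frac1\lambda$ and $D_s=\frac1\mu$. Suppose $D_s<D_a$. For an agent following the random waypoint trajectory under D/D/1 queuing (waypoint intervals $Y_j=D_a$ deterministic, service times $S_i=D_s$ deterministic, each waypoint update polled independently with probability $p$, first-come-first-served single server in steady state), the Age of Positioning is ${\rm AoP}=p\,\kappa\,\lambda\,\mathbb{E}[Q_i]$, where $$\mathbb{E}[Q_i]= \frac{v^2 D_a^2 D_s}{p} +\frac{v^2 D_a^3}{3p} +\frac{v^2 D_a^3 (1-p)}{p^2}.$$
   Context: An agent moves in the plane in successive hops with constant speed $v$; at the end of each hop (a waypoint) it picks a new direction uniformly in $(0,2\pi]$, independently. Waypoints are generated by an arrival process of rate $\lambda$. At each waypoint a position update is generated and, independently of everything else, is transmitted ("polled") with probability $p$ and otherwise discarded. Polled updates enter a single-server first-come-first-served queue with service rate $\mu$ and become available at the central server on departure. Service times are independent of the arrival and polling processes. In the notation A/B/1, A refers to the waypoint generation process before polling and B to the service process. Let $X_i$ be the time between the $(i-1)$-th and the $i$-th polled updates. Then $X_i=\sum_{j=1}^{k}Y_j$, where $Y_1,\dots,Y_k$ are the durations of the successive hops between these two polled updates and $k$ is the number of such hops, geometric with $\Pr(k=n)=p(1-p)^{n-1}$, $n\ge 1$. For D arrivals $Y_j=D_a=1/\lambda$ for all $j$. Let $S_i$ be the service time of the $i$-th polled update (for D service: $S_i=D_s=1/\mu$) and let $T_i=W_i+S_i$ be its total time in the system, with waiting time $W_i=(T_{i-1}-X_i)^+$.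 The queue is in steady state. The position error bound of the position estimate computed from the last available update, after hops of durations $\delta_1,\dots,\delta_h$ since that update was generated, is ${\rm PEB}={\rm PEB}_{\rm o}+\kappa\sum_{l=1}^{h}v^2\delta_l^2$, where ${\rm PEB}_{\rm o}$ is the bound at the instant the update was generated; $\kappa=1$ in the motion agnostic mode and $\kappa=\epsilon^2/3$ in the dead-reckoning aided mode (direction sensor errors uniform on $(-\epsilon,\epsilon)$, $\epsilon$ small). The Age of Positioning (AoP) is the long-run time average of ${\rm PEB}(t)-{\rm PEB}_{\rm o}$; it is expressed as (and may be taken here to be defined by) $${\rm AoP}=p\,\kappa\,\lambda\,\mathbb{E}[Q_i],\qquad Q_i=G_1+G_2+G_3,$$ $$G_1=\sum_{j=1}^{k}\frac{v^2}{3}Y_j^3,\qquad G_2=\sum_{j=1}^{k}Y_j\Big(\sum_{l=1}^{j-1}v^2Y_l^2\Big),\qquad G_3=H_iT_i,\qquad H_i=\sum_{j=1}^{k}v^2Y_j^2 .$$ *)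

theory Defs
  imports "HOL-Probability.Probability"
begin

text \<open>
  Polled updates are numbered by \<open>i\<close>.  \<open>k i\<close> is the number of hops between the polled updates
  \<open>i - 1\<close> and \<open>i\<close>, \<open>Y i j\<close> is the duration of the \<open>j\<close>-th of these hops, and \<open>S i\<close> is the service
  time of update \<open>i\<close> (\<open>i, j \<ge> 1\<close>).  \<open>T0\<close> is the total system time of update 0, i.e. the state in
  which the queue is observed first.  The values \<open>Y i j\<close> with \<open>j > k i\<close> are never used.
\<close>

definition interpoll_time ::
  "(nat \<Rightarrow> 'a \<Rightarrow> nat) \<Rightarrow> (nat \<Rightarrow> nat \<Rightarrow> 'a \<Rightarrow> real) \<Rightarrow> nat \<Rightarrow> 'a \<Rightarrow> real" where
  "interpoll_time k Y i \<omega> = (\<Sum>j = 1..k i \<omega>. Y i j \<omega>)"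

text \<open>The summand \<open>max 0 \<dots>\<close> is the waiting time \<open>W\<^sub>i = (T\<^sub>i\<^sub>-\<^sub>1 - X\<^sub>i)\<^sup>+\<close>.\<close>

primrec system_time ::
  "(nat \<Rightarrow> 'a \<Rightarrow> nat) \<Rightarrow> (nat \<Rightarrow> nat \<Rightarrow> 'a \<Rightarrow> real) \<Rightarrow> (nat \<Rightarrow> 'a \<Rightarrow> real) \<Rightarrow> ('a \<Rightarrow> real)
    \<Rightarrow> nat \<Rightarrow> 'a \<Rightarrow> real" where
  "system_time k Y S T0 0 = T0"
| "system_time k Y S T0 (Suc n) =
    (\<lambda>\<omega>. max 0 (system_time k Y S T0 n \<omega> - interpoll_time k Y (Suc n) \<omega>) + S (Suc n) \<omega>)"

text \<open>Index type used to state the joint independence of all primitive random variables.\<close>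

datatype source = Init | Hops nat | Duration nat nat | Service nat

fun source_var ::
  "(nat \<Rightarrow> 'a \<Rightarrow> nat) \<Rightarrow> (nat \<Rightarrow> nat \<Rightarrow> 'a \<Rightarrow> real) \<Rightarrow> (nat \<Rightarrow> 'a \<Rightarrow> real) \<Rightarrow> ('a \<Rightarrow> real)
    \<Rightarrow> source \<Rightarrow> 'a \<Rightarrow> real" where
  "source_var k Y S T0 Init = T0"
| "source_var k Y S T0 (Hops i) = (\<lambda>\<omega>. real (k i \<omega>))"
| "source_var k Y S T0 (Duration i j) = Y i j"
| "source_var k Y S T0 (Service i) = S i"

definition sources :: "source set" where
  "sources = {Init} \<union> Hops ` {1..} \<union> (\<Union>i\<in>{1..}. Duration i ` {1..}) \<union> Service ` {1..}"

text \<open>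
  The single-server first-come-first-served queue of polled updates in steady state.  As \<open>T0\<close> is
  independent of all later hops and services, the system times form a Markov chain when the
  durations and the service times are each identically distributed, and equality of the
  one-dimensional laws then is the same as stationarity of the whole sequence.
\<close>

locale polled_queue = prob_space M
  for M :: "'a measure" +
  fixes p :: real
    and k :: "nat \<Rightarrow> 'a \<Rightarrow> nat"
    and Y :: "nat \<Rightarrow> nat \<Rightarrow> 'a \<Rightarrow> real"
    and S :: "nat \<Rightarrow> 'a \<Rightarrow> real"
    and T0 :: "'a \<Rightarrow> real"
  assumes independent: "indep_vars (\<lambda>_. borel) (source_var k Y S T0) sources"
    and geometric: "\<And>i n. i \<ge> 1 \<Longrightarrow> n \<ge> 1 \<Longrightarrow>
          prob {\<omega> \<in> space M. k i \<omega> = n} = p * (1 - p) ^ (n - 1)"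
    and steady_state: "\<And>n. distr M borel (system_time k Y S T0 n) = distr M borel T0"

locale dd1_queue = polled_queue M p k Y S T0
  for M :: "'a measure" and p k Y S T0 +
  fixes D_a D_s :: real
  assumes deterministic_hops:
      "\<And>i j \<omega>. i \<ge> 1 \<Longrightarrow> j \<ge> 1 \<Longrightarrow> \<omega> \<in> space M \<Longrightarrow> Y i j \<omega> = D_a"
    and deterministic_service:
      "\<And>i \<omega>. i \<ge> 1 \<Longrightarrow> \<omega> \<in> space M \<Longrightarrow> S i \<omega> = D_s"

text \<open>
  The argument of \<open>Dead_Reckoning\<close> is \<open>\<epsilon>\<close>: direction errors are uniform on \<open>(-\<epsilon>, \<epsilon>)\<close>, and
  their variance is \<open>\<epsilon>\<^sup>2 / 3\<close>.
\<close>

datatype positioning_mode = Motion_Agnostic | Dead_Reckoning real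

fun kappa :: "positioning_mode \<Rightarrow> real" where
  "kappa Motion_Agnostic = 1"
| "kappa (Dead_Reckoning \<epsilon>) = \<epsilon>\<^sup>2 / 3"

text \<open>
  \<open>Q i\<close> is the \<open>\<kappa>\<close>-free area under the growth of the error bound that is charged to the interval
  before polled update \<open>i\<close>: within a hop (\<open>G1\<close>, from \<open>v\<^sup>2 y\<^sup>3 / 3 = \<integral> v\<^sup>2 t\<^sup>2 dt\<close> over \<open>[0, y]\<close>), carried
  over from the earlier hops of the interval (\<open>G2\<close>), and while update \<open>i\<close> is in the queue (\<open>G3\<close>).
\<close>

definition G1 ::
  "real \<Rightarrow> (nat \<Rightarrow> 'a \<Rightarrow> nat) \<Rightarrow> (nat \<Rightarrow> nat \<Rightarrow> 'a \<Rightarrow> real) \<Rightarrow> nat \<Rightarrow> 'a \<Rightarrow> real" where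
  "G1 v k Y i \<omega> = (\<Sum>j = 1..k i \<omega>. v\<^sup>2 / 3 * Y i j \<omega> ^ 3)"

definition G2 ::
  "real \<Rightarrow> (nat \<Rightarrow> 'a \<Rightarrow> nat) \<Rightarrow> (nat \<Rightarrow> nat \<Rightarrow> 'a \<Rightarrow> real) \<Rightarrow> nat \<Rightarrow> 'a \<Rightarrow> real" where
  "G2 v k Y i \<omega> = (\<Sum>j = 1..k i \<omega>. Y i j \<omega> * (\<Sum>l = 1..<j. v\<^sup>2 * (Y i l \<omega>)\<^sup>2))"

definition H ::
  "real \<Rightarrow> (nat \<Rightarrow> 'a \<Rightarrow> nat) \<Rightarrow> (nat \<Rightarrow> nat \<Rightarrow> 'a \<Rightarrow> real) \<Rightarrow> nat \<Rightarrow> 'a \<Rightarrow> real" where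
  "H v k Y i \<omega> = (\<Sum>j = 1..k i \<omega>. v\<^sup>2 * (Y i j \<omega>)\<^sup>2)"

definition G3 ::
  "real \<Rightarrow> (nat \<Rightarrow> 'a \<Rightarrow> nat) \<Rightarrow> (nat \<Rightarrow> nat \<Rightarrow> 'a \<Rightarrow> real) \<Rightarrow> (nat \<Rightarrow> 'a \<Rightarrow> real)
    \<Rightarrow> ('a \<Rightarrow> real) \<Rightarrow> nat \<Rightarrow> 'a \<Rightarrow> real" where
  "G3 v k Y S T0 i \<omega> = H v k Y i \<omega> * system_time k Y S T0 i \<omega>"

definition Q ::
  "real \<Rightarrow> (nat \<Rightarrow> 'a \<Rightarrow> nat) \<Rightarrow> (nat \<Rightarrow> nat \<Rightarrow> 'a \<Rightarrow> real) \<Rightarrow> (nat \<Rightarrow> 'a \<Rightarrow> real)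
    \<Rightarrow> ('a \<Rightarrow> real) \<Rightarrow> nat \<Rightarrow> 'a \<Rightarrow> real" where
  "Q v k Y S T0 i \<omega> = G1 v k Y i \<omega> + G2 v k Y i \<omega> + G3 v k Y S T0 i \<omega>"

text \<open>
  The age of positioning, computed from the interval that ends with the polled update \<open>i \<ge> 1\<close>;
  in steady state the choice of \<open>i\<close> is immaterial.
\<close>

definition AoP ::
  "'a measure \<Rightarrow> real \<Rightarrow> positioning_mode \<Rightarrow> real \<Rightarrow> real \<Rightarrow> (nat \<Rightarrow> 'a \<Rightarrow> nat)
    \<Rightarrow> (nat \<Rightarrow> nat \<Rightarrow> 'a \<Rightarrow> real) \<Rightarrow> (nat \<Rightarrow> 'a \<Rightarrow> real) \<Rightarrow> ('a \<Rightarrow> real) \<Rightarrow> nat \<Rightarrow> real" where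
  "AoP M p mode lam v k Y S T0 i =
    p * kappa mode * lam * prob_space.expectation M (Q v k Y S T0 i)"

end

theory Submission
  imports Defs
begin

text \<open>
  As \<open>D_s < D_a\<close> and every interval between polled updates contains a hop almost surely, each update
  lowers an excess of the system time over \<open>D_s\<close> by at least \<open>D_a - D_s\<close>, until the excess vanishes.
  Hence \<open>P (T\<^sub>n > D_s) \<le> P (T\<^sub>0 > D_s + n (D_a - D_s)) \<longlonglongrightarrow> 0\<close>, while stationarity makes the left-hand side
  constant in \<open>n\<close>. So \<open>T\<^sub>i = D_s\<close> almost surely, \<open>Q\<^sub>i\<close> is a quadratic polynomial in the geometric
  variable \<open>k\<^sub>i\<close>, and only \<open>E k = 1 / p\<close> and \<open>E (k choose 2) = (1 - p) / p\<^sup>2\<close> are needed.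
\<close>

section \<open>Power series, and expectations of functions of a discrete variable\<close>

text \<open>The Cauchy product of \<open>\<Sum>n. (n + 1) * z ^ n\<close> with the geometric series
  has the triangular numbers \<open>n + 2 choose 2\<close> as coefficients. The exponent
  \<open>n - 1\<close> is the one in the geometric law.\<close>

lemma choose_two_sums:
  fixes z :: real
  assumes "norm z < 1"
  shows "(\<lambda>n. real (n choose 2) * z ^ (n - 1)) sums (z / (1 - z) ^ 3)"
proof -
  have abs1: "summable (\<lambda>n. norm (real (Suc n) * z ^ n))"
    using sums_summable[OF geometric_deriv_sums[of "norm z"]] assms
    by (simp add: abs_mult power_abs)
  have abs2: "summable (\<lambda>n. norm (z ^ n))"
    using assms by (simp add: power_abs summable_geometric)
  have part: "(\<Sum>i\<le>n. real (Suc i)) = real (n + 2 choose 2)" for n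
    by (induction n) (simp_all add: numeral_2_eq_2)
  have "(\<lambda>n. \<Sum>i\<le>n. (real (Suc i) * z ^ i) * z ^ (n - i))
          sums ((\<Sum>n. real (Suc n) * z ^ n) * (\<Sum>n. z ^ n))"
    by (rule Cauchy_product_sums[OF abs1 abs2])
  moreover have "(\<Sum>n. real (Suc n) * z ^ n) * (\<Sum>n. z ^ n) = 1 / (1 - z) ^ 3"
    unfolding sums_unique[OF geometric_deriv_sums[OF assms], symmetric]
      sums_unique[OF geometric_sums[OF assms], symmetric]
    by (simp add: power2_eq_square power3_eq_cube)
  moreover have "(\<Sum>i\<le>n. (real (Suc i) * z ^ i) * z ^ (n - i)) = real (n + 2 choose 2) * z ^ n" for n
  proof -
    have "(\<Sum>i\<le>n. (real (Suc i) * z ^ i) * z ^ (n - i)) = (\<Sum>i\<le>n. real (Suc i) * z ^ n)"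
      by (rule sum.cong) (simp_all add: power_add[symmetric] mult.assoc)
    then show ?thesis
      by (simp only: sum_distrib_right[symmetric] part)
  qed
  ultimately have "(\<lambda>n. real (n + 2 choose 2) * z ^ n) sums (1 / (1 - z) ^ 3)"
    by simp
  \<comment> \<open>The extra factor \<open>z\<close> makes the exponent
    \<open>n + 1 = (n + 2) - 1\<close>, so this is the desired series shifted by two; the skipped
    terms vanish because \<open>0 choose 2 = 1 choose 2 = 0\<close>.\<close>
  from sums_mult[OF this, of z]
  have "(\<lambda>n. real (n + 2 choose 2) * z ^ (n + 2 - 1)) sums (z / (1 - z) ^ 3)"
    by (simp add: algebra_simps)
  then show ?thesis
    by (subst sums_iff_shift'[of _ 2, symmetric])
       (simp add: lessThan_Suc numeral_2_eq_2)
qed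

text \<open>The law of \<open>K\<close> has its mass function as density with respect to counting
  measure, so the expectation is a series. Nonnegativity makes its convergence absolute, which
  yields integrability along with the value.\<close>

lemma (in prob_space) has_bochner_integral_nat_valued:
  fixes K :: "'a \<Rightarrow> nat" and f :: "nat \<Rightarrow> real"
  assumes [measurable]: "K \<in> measurable M (count_space UNIV)"
    and nonneg: "\<And>n. 0 \<le> f n"
    and sums: "(\<lambda>n. prob {\<omega> \<in> space M. K \<omega> = n} * f n) sums s"
  shows "has_bochner_integral M (\<lambda>\<omega>. f (K \<omega>)) s"
proof -
  let ?q = "\<lambda>n. prob {\<omega> \<in> space M. K \<omega> = n}"
  have law: "distr M (count_space UNIV) K = density (count_space UNIV) (\<lambda>n. ennreal (?q n))"
  proof (rule measure_eqI_countable[of _ UNIV])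
    fix n :: nat
    have "K -` {n} \<inter> space M = {\<omega> \<in> space M. K \<omega> = n}"
      by auto
    then show "emeasure (distr M (count_space UNIV) K) {n}
        = emeasure (density (count_space UNIV) (\<lambda>n. ennreal (?q n))) {n}"
      by (simp add: emeasure_distr emeasure_density emeasure_eq_measure
            nn_integral_count_space_indicator[symmetric] nn_integral_count_space_finite)
  qed auto
  have count: "has_bochner_integral (count_space UNIV) (\<lambda>n. ?q n * f n) s"
  proof -
    have int: "integrable (count_space UNIV) (\<lambda>n. ?q n * f n)"
      using sums nonneg by (simp add: integrable_count_space_nat_iff abs_mult sums_iff)
    then show ?thesis
      using sums sums_integral_count_space_nat[OF int]
      by (auto simp: has_bochner_integral_iff intro: sums_unique2)
  qed
  then have "has_bochner_integral (density (count_space UNIV) (\<lambda>n. ennreal (?q n))) f s"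
    by (intro has_bochner_integral_density) simp_all
  then show ?thesis
    unfolding law[symmetric]
    by (simp add: has_bochner_integral_iff integrable_distr_eq integral_distr)
qed

section \<open>Law and moments of the number of hops\<close>

context polled_queue
begin

lemma hops_measurable:
  assumes "i \<ge> 1"
  shows "k i \<in> measurable M (count_space UNIV)"
proof -
  have "Hops i \<in> sources"
    using assms by (simp add: sources_def)
  with independent have [measurable]: "(\<lambda>\<omega>. real (k i \<omega>)) \<in> borel_measurable M"
    unfolding indep_vars_def by fastforce
  \<comment> \<open>Independence gives measurability only of the real-valued copy of
    \<open>k i\<close>; rounding recovers \<open>k i\<close> itself.\<close>
  have "(\<lambda>\<omega>. nat \<lfloor>real (k i \<omega>)\<rfloor>) \<in> measurable M (count_space UNIV)"
    by measurable
  then show ?thesis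
    by simp
qed

lemma initial_measurable: "T0 \<in> borel_measurable M"
proof -
  have "Init \<in> sources"
    by (simp add: sources_def)
  with independent show ?thesis
    unfolding indep_vars_def by fastforce
qed

text \<open>The geometric masses at \<open>n \<ge> 1\<close> already sum to 1, which leaves no mass
  for the value 0.\<close>

lemma AE_hops_pos:
  assumes "0 < p" "p \<le> 1" "i \<ge> 1"
  shows "AE \<omega> in M. k i \<omega> \<ge> 1"
proof -
  note [measurable] = hops_measurable[OF \<open>i \<ge> 1\<close>]
  have "(\<lambda>n. prob {\<omega> \<in> space M. k i \<omega> = Suc n}) sums prob (\<Union>n. {\<omega> \<in> space M. k i \<omega> = Suc n})"
    by (rule finite_measure_UNION) (auto simp: disjoint_family_on_def)
  moreover have "(\<lambda>n. prob {\<omega> \<in> space M. k i \<omega> = Suc n}) sums 1"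
    using geometric[OF \<open>i \<ge> 1\<close>] assms sums_mult[OF geometric_sums[of "1 - p"], of p] by simp
  moreover have "(\<Union>n. {\<omega> \<in> space M. k i \<omega> = Suc n}) = {\<omega> \<in> space M. k i \<omega> \<ge> 1}"
    by (auto simp: Suc_le_eq gr0_conv_Suc)
  ultimately have "prob {\<omega> \<in> space M. k i \<omega> \<ge> 1} = 1"
    by (auto dest: sums_unique2)
  then show ?thesis
    by (subst (asm) prob_Collect_eq_1) auto
qed

lemma has_bochner_integral_hops:
  assumes "0 < p" "p \<le> 1" "i \<ge> 1"
  shows "has_bochner_integral M (\<lambda>\<omega>. real (k i \<omega>)) (1 / p)"
proof (rule has_bochner_integral_nat_valued[OF hops_measurable[OF \<open>i \<ge> 1\<close>]])
  have "(\<lambda>n. p * (real (Suc n) * (1 - p) ^ n)) sums (p * (1 / (1 - (1 - p))\<^sup>2))"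
    using assms by (intro sums_mult geometric_deriv_sums) auto
  then have "(\<lambda>n. prob {\<omega> \<in> space M. k i \<omega> = Suc n} * real (Suc n)) sums (1 / p)"
    using assms geometric[OF \<open>i \<ge> 1\<close>] by (simp add: power2_eq_square mult_ac)
  \<comment> \<open>The term at \<open>n = 0\<close> is zero, so shifting the index does not change
    the sum.\<close>
  then show "(\<lambda>n. prob {\<omega> \<in> space M. k i \<omega> = n} * real n) sums (1 / p)"
    by (subst (asm) sums_Suc_iff) simp
qed simp

lemma has_bochner_integral_hops_choose_two:
  assumes "0 < p" "p \<le> 1" "i \<ge> 1"
  shows "has_bochner_integral M (\<lambda>\<omega>. real (k i \<omega> choose 2)) ((1 - p) / p\<^sup>2)"
proof (rule has_bochner_integral_nat_valued[OF hops_measurable[OF \<open>i \<ge> 1\<close>]])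
  have "(\<lambda>n. p * (real (n choose 2) * (1 - p) ^ (n - 1))) sums (p * ((1 - p) / (1 - (1 - p)) ^ 3))"
    using assms by (intro sums_mult choose_two_sums) auto
  \<comment> \<open>The geometric law is stated for \<open>n \<ge> 1\<close> only; at
    \<open>n = 0\<close> both sides vanish through the binomial coefficient.\<close>
  moreover have "p * (real (n choose 2) * (1 - p) ^ (n - 1))
      = prob {\<omega> \<in> space M. k i \<omega> = n} * real (n choose 2)" for n
    using geometric[OF \<open>i \<ge> 1\<close>, of n] by (cases n) (auto simp: mult_ac)
  moreover have "p * ((1 - p) / (1 - (1 - p)) ^ 3) = (1 - p) / p\<^sup>2"
    using assms by (simp add: power2_eq_square power3_eq_cube)
  ultimately show "(\<lambda>n. prob {\<omega> \<in> space M. k i \<omega> = n} * real (n choose 2)) sums ((1 - p) / p\<^sup>2)"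
    by (simp only:)
qed simp

end

section \<open>Collapse of the stationary system time to the service time\<close>

context dd1_queue
begin

lemma interpoll_time_eq:
  assumes "i \<ge> 1" "\<omega> \<in> space M"
  shows "interpoll_time k Y i \<omega> = real (k i \<omega>) * D_a"
  using assms deterministic_hops by (simp add: interpoll_time_def)

lemma system_time_measurable: "system_time k Y S T0 n \<in> borel_measurable M"
proof (induction n)
  case 0
  then show ?case
    by (simp add: initial_measurable)
next
  case (Suc n)
  note [measurable] = Suc.IH hops_measurable[of "Suc n", simplified]
  have "(\<lambda>\<omega>. max 0 (system_time k Y S T0 n \<omega> - real (k (Suc n) \<omega>) * D_a) + D_s)
      \<in> borel_measurable M"
    by measurable
  then show ?case
    by (rule measurable_cong[THEN iffD1, rotated])
       (simp add: interpoll_time_eq deterministic_service)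
qed

lemma system_time_ge:
  assumes "i \<ge> 1" "\<omega> \<in> space M"
  shows "D_s \<le> system_time k Y S T0 i \<omega>"
  using assms by (cases i) (simp_all add: deterministic_service)

text \<open>One update subtracts at least \<open>D_a\<close> before truncation at 0 and then adds
  \<open>D_s\<close>. The second argument of \<open>max\<close> thus drops by
  \<open>D_a - D_s\<close>, while the level \<open>D_s\<close> is preserved because
  \<open>D_s \<le> D_a\<close>.\<close>

lemma system_time_le:
  assumes "\<And>i. i \<ge> 1 \<Longrightarrow> k i \<omega> \<ge> 1" "\<omega> \<in> space M" "0 \<le> D_a" "D_s \<le> D_a"
  shows "system_time k Y S T0 n \<omega> \<le> max D_s (T0 \<omega> - real n * (D_a - D_s))"
proof (induction n)
  case 0
  then show ?case
    by simp
next
  case (Suc n)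
  have "D_a \<le> interpoll_time k Y (Suc n) \<omega>"
    using assms(1)[of "Suc n"] assms(2,3) mult_right_mono[of 1 "real (k (Suc n) \<omega>)" D_a]
    by (simp add: interpoll_time_eq)
  moreover have "system_time k Y S T0 (Suc n) \<omega> =
      max 0 (system_time k Y S T0 n \<omega> - interpoll_time k Y (Suc n) \<omega>) + D_s"
    using assms(2) by (simp add: deterministic_service)
  moreover have "real (Suc n) * (D_a - D_s) = real n * (D_a - D_s) + (D_a - D_s)"
    by (simp add: distrib_right)
  ultimately show ?case
    using Suc.IH assms(4) by linarith
qed

lemma AE_system_time_eq:
  assumes "0 < p" "p \<le> 1" "0 \<le> D_a" "D_s < D_a" "i \<ge> 1"
  shows "AE \<omega> in M. system_time k Y S T0 i \<omega> = D_s"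
proof -
  note [measurable] = system_time_measurable initial_measurable
  let ?T = "system_time k Y S T0"
  have stationary: "prob {\<omega> \<in> space M. ?T n \<omega> > D_s} = prob {\<omega> \<in> space M. T0 \<omega> > D_s}" for n
  proof -
    have "measure (distr M borel (?T n)) {D_s<..} = measure (distr M borel T0) {D_s<..}"
      by (simp add: steady_state)
    then show ?thesis
      by (simp add: measure_distr vimage_def Int_def conj_commute)
  qed
  \<comment> \<open>Countably many null sets are merged so that the pathwise bound applies to all
    updates at once.\<close>
  have "AE \<omega> in M. \<forall>j. j \<ge> 1 \<longrightarrow> k j \<omega> \<ge> 1"
    using AE_hops_pos[OF assms(1,2)] by (subst AE_all_countable) auto
  then have tail: "AE \<omega> in M. ?T n \<omega> > D_s \<longrightarrow> T0 \<omega> > D_s + real n * (D_a - D_s)" for n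
    using AE_space
  proof eventually_elim
    case (elim \<omega>)
    then have "?T n \<omega> \<le> max D_s (T0 \<omega> - real n * (D_a - D_s))"
      using assms(3,4) by (intro system_time_le) auto
    then show ?case
      by (auto simp: max_def split: if_splits)
  qed
  have le: "prob {\<omega> \<in> space M. T0 \<omega> > D_s}
      \<le> prob {\<omega> \<in> space M. T0 \<omega> > D_s + real n * (D_a - D_s)}" for n
    unfolding stationary[of n, symmetric] by (rule finite_measure_mono_AE) (use tail in auto)
  let ?A = "\<lambda>n. {\<omega> \<in> space M. T0 \<omega> > D_s + real n * (D_a - D_s)}"
  \<comment> \<open>Continuity from above; the intersection is empty because \<open>T0\<close> is
    real-valued and \<open>D_a - D_s > 0\<close>.\<close>
  have "(\<lambda>n. prob (?A n)) \<longlonglongrightarrow> prob (\<Inter>n. ?A n)"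
  proof (rule finite_Lim_measure_decseq)
    show "decseq ?A"
    proof (rule decseq_SucI)
      have "real n * (D_a - D_s) \<le> real (Suc n) * (D_a - D_s)" for n
        using assms(4) by (intro mult_right_mono) auto
      then show "?A (Suc n) \<subseteq> ?A n" for n
        by (smt (verit) Collect_mono)
    qed
  qed auto
  moreover have "(\<Inter>n. ?A n) = {}"
  proof -
    have "\<exists>n. T0 \<omega> \<le> D_s + real n * (D_a - D_s)" for \<omega>
    proof -
      obtain n where "T0 \<omega> - D_s < real n * (D_a - D_s)"
        using reals_Archimedean3[of "D_a - D_s"] assms(4) by auto
      then show ?thesis
        by (intro exI[of _ n]) simp
    qed
    then show ?thesis
      by (blast dest: leD)
  qed
  ultimately have "prob {\<omega> \<in> space M. T0 \<omega> > D_s} \<le> 0"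
    using le by (intro LIMSEQ_le_const[of "\<lambda>n. prob (?A n)"]) auto
  then have "prob {\<omega> \<in> space M. ?T i \<omega> > D_s} = 0"
    using stationary[of i] by (simp add: measure_le_0_iff)
  then have "AE \<omega> in M. \<not> ?T i \<omega> > D_s"
    by (subst (asm) prob_eq_0) auto
  then show ?thesis
    using AE_space
  proof eventually_elim
    case (elim \<omega>)
    then show ?case
      using system_time_ge[OF \<open>i \<ge> 1\<close>, of \<omega>] by simp
  qed
qed

section \<open>Evaluation of \<open>Q\<close> and its expectation\<close>

text \<open>With constant hops, \<open>G1\<close> and \<open>H\<close> are linear in
  \<open>k i\<close>, and \<open>G2\<close> counts the pairs \<open>l < j\<close> of hops, hence the
  binomial coefficient. The system time is still random here, so the identity holds at every point
  of the space.\<close>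

lemma Q_eq:
  assumes "i \<ge> 1" "\<omega> \<in> space M"
  shows "Q v k Y S T0 i \<omega> =
    (v\<^sup>2 * D_a ^ 3 / 3 + v\<^sup>2 * D_a\<^sup>2 * system_time k Y S T0 i \<omega>) * real (k i \<omega>) + v\<^sup>2 * D_a ^ 3 * real (k i \<omega> choose 2)"
proof -
  have hop: "Y i j \<omega> = D_a" if "j \<ge> 1" for j
    using that assms deterministic_hops by simp
  have G1: "G1 v k Y i \<omega> = v\<^sup>2 / 3 * D_a ^ 3 * real (k i \<omega>)"
    by (simp add: G1_def hop)
  have H: "H v k Y i \<omega> = v\<^sup>2 * D_a\<^sup>2 * real (k i \<omega>)"
    by (simp add: H_def hop)
  have triangle: "(\<Sum>j = 1..n. D_a * (real (j - 1) * (v\<^sup>2 * D_a\<^sup>2)))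
      = v\<^sup>2 * D_a ^ 3 * real (n choose 2)" for n
    by (induction n) (simp_all add: numeral_2_eq_2 algebra_simps power3_eq_cube)
  have "G2 v k Y i \<omega> = (\<Sum>j = 1..k i \<omega>. D_a * (real (j - 1) * (v\<^sup>2 * D_a\<^sup>2)))"
    unfolding G2_def by (intro sum.cong) (simp_all add: hop)
  with triangle have G2: "G2 v k Y i \<omega> = v\<^sup>2 * D_a ^ 3 * real (k i \<omega> choose 2)"
    by simp
  show ?thesis
    by (simp add: Q_def G1 G2 G3_def H algebra_simps)
qed

lemma expectation_Q:
  assumes "0 < p" "p \<le> 1" "0 \<le> D_a" "D_s < D_a" "i \<ge> 1"
  shows "expectation (Q v k Y S T0 i) =
    v\<^sup>2 * D_a\<^sup>2 * D_s / p + v\<^sup>2 * D_a ^ 3 / (3 * p) + v\<^sup>2 * D_a ^ 3 * (1 - p) / p\<^sup>2"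
proof -
  let ?R = "\<lambda>\<omega>. (v\<^sup>2 * D_a ^ 3 / 3 + v\<^sup>2 * D_a\<^sup>2 * D_s) * real (k i \<omega>)
    + v\<^sup>2 * D_a ^ 3 * real (k i \<omega> choose 2)"
  note [measurable] = hops_measurable[OF \<open>i \<ge> 1\<close>] system_time_measurable
  \<comment> \<open>The exact identity \<open>Q_eq\<close> supplies the measurability that
    \<open>integral_cong_AE\<close> demands before the system time is replaced by
    \<open>D_s\<close>.\<close>
  have "Q v k Y S T0 i \<in> borel_measurable M"
    by (subst measurable_cong, erule Q_eq[OF \<open>i \<ge> 1\<close>]) measurable
  moreover have "AE \<omega> in M. Q v k Y S T0 i \<omega> = ?R \<omega>"
    using AE_system_time_eq[OF assms] AE_space
  proof eventually_elim
    case (elim \<omega>)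
    show ?case
      using Q_eq[OF \<open>i \<ge> 1\<close> elim(2), of v] unfolding elim(1) .
  qed
  moreover have "?R \<in> borel_measurable M"
    by measurable
  ultimately have "expectation (Q v k Y S T0 i) = expectation ?R"
    by (intro integral_cong_AE)
  also have "\<dots> = (v\<^sup>2 * D_a ^ 3 / 3 + v\<^sup>2 * D_a\<^sup>2 * D_s) * (1 / p) + v\<^sup>2 * D_a ^ 3 * ((1 - p) / p\<^sup>2)"
    using has_bochner_integral_hops[OF assms(1,2,5)]
      has_bochner_integral_hops_choose_two[OF assms(1,2,5)]
    by (intro has_bochner_integral_integral_eq has_bochner_integral_add
          has_bochner_integral_mult_right) auto
  finally show ?thesis
    using assms(1) by (simp add: add_divide_distrib distrib_right mult_ac)
qed

end

theorem theorem2: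
  fixes M :: "'a measure"
    and v lam mu p D_a D_s :: real
    and mode :: positioning_mode
    and k :: "nat \<Rightarrow> 'a \<Rightarrow> nat"
    and Y :: "nat \<Rightarrow> nat \<Rightarrow> 'a \<Rightarrow> real"
    and S :: "nat \<Rightarrow> 'a \<Rightarrow> real"
    and T0 :: "'a \<Rightarrow> real"
    and i :: nat
  assumes "v > 0" "lam > 0" "mu > 0" "0 < p" "p \<le> 1"
    and "\<And>\<epsilon>. mode = Dead_Reckoning \<epsilon> \<Longrightarrow> \<epsilon> > 0"
    and "D_a = 1 / lam" "D_s = 1 / mu"
    and "D_s < D_a"
    and "dd1_queue M p k Y S T0 D_a D_s"
    and "i \<ge> 1"
  shows "AoP M p mode lam v k Y S T0 i =
           p * kappa mode * lam * prob_space.expectation M (Q v k Y S T0 i) \<and>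
         prob_space.expectation M (Q v k Y S T0 i) =
           v\<^sup>2 * D_a\<^sup>2 * D_s / p + v\<^sup>2 * D_a ^ 3 / (3 * p) + v\<^sup>2 * D_a ^ 3 * (1 - p) / p\<^sup>2"
proof -
  interpret dd1_queue M p k Y S T0 D_a D_s
    by fact
  show ?thesis
    using assms by (simp add: AoP_def expectation_Q)
qed

end
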